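(* Fix any constant $\varepsilon>0$. For all integers $n\le m$ there is a one-sided $\varepsilon$-error randomized bit-probe scheme with cached auxiliary word for storing subsets $A\subseteq\{1,\ldots,m\}$ with $|A|\le n$, in which the main storage $B$ is a bit string of length $O(n\log^2 m)$ and the auxiliary word $C$ has length $\mathrm{poly}(\log m)$. Each membership query ``$x\in A$?'' is answered with one bit probe to $B$: for $x\in A$ the answer is always correct, and for each $x\notin A$ the probability of error is less than $\varepsilon$. The position of the bit probed in $B$ is computed from $x$ and the auxiliary word $C$ (and the random coins) in time $\mathrm{poly}(\log m)$.
   Context: A randomized bit-probe scheme with cached auxiliary word (for parameters $n,m$) assigns to each set $A\subseteq\{1,\ldots,m\}$ with $|A|\le n$ a pair $(C,B)$ of bit strings, where $C$ is a short ``cached'' word and $B$ is the main storage; both may depend on $A$. A query ``$x\in A$?'' for $x\in\{1,\ldots,m\}$ is answered by a randomized algorithm that may read all of $C$, uses $x$, $C$ and its coin tosses to choose a position in $B$, reads only that one bit of $B$ (one bit probe), and outputs ``yes'' or ``no'' based on $x$, $C$, its coins and the bit read. The scheme has one-sided error $\varepsilon$ if for every such $A$: for every $x\in A$ the answer is ``yes'' with probability $1$, and for every $x\notin A$ the answer is ``yes'' with probability less than $\varepsilon$ (over the coin tosses). The constants in $O(\cdot)$ and $\mathrm{poly}(\cdot)$ may depend on $\varepsilon$. *)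

theory Defs
  imports "HOL-Probability.Probability_Mass_Function"
    "HOL-Computational_Algebra.Polynomial" "HOL-Library.Log_Nat"
begin

text \<open>A scheme for fixed parameters. The maps \<open>cached\<close> and \<open>storage\<close> are the two parts of the
  encoding of a set. The coin tosses of a query form a uniformly random word of length \<open>ncoins\<close>.
  Note that \<open>probe\<close> and \<open>answer\<close> see neither the set nor the main storage: the latter is
  accessed only through the one bit handed to \<open>answer\<close>.\<close>

record bit_probe_scheme =
  cached  :: "nat set \<Rightarrow> bool list"
  storage :: "nat set \<Rightarrow> bool list"
  ncoins  :: nat
  probe   :: "nat \<Rightarrow> bool list \<Rightarrow> bool list \<Rightarrow> nat"
  answer  :: "nat \<Rightarrow> bool list \<Rightarrow> bool list \<Rightarrow> bool \<Rightarrow> bool"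

definition coins :: "bit_probe_scheme \<Rightarrow> bool list pmf" where
  "coins S = pmf_of_set {r. length r = ncoins S}"

definition query :: "bit_probe_scheme \<Rightarrow> nat set \<Rightarrow> nat \<Rightarrow> bool list \<Rightarrow> bool" where
  "query S A x r =
     answer S x (cached S A) r (storage S A ! probe S x (cached S A) r)"

definition storable :: "nat \<Rightarrow> nat \<Rightarrow> nat set \<Rightarrow> bool" where
  "storable n m A \<longleftrightarrow> A \<subseteq> {1..m} \<and> card A \<le> n"

definition one_sided_scheme :: "real \<Rightarrow> nat \<Rightarrow> nat \<Rightarrow> bit_probe_scheme \<Rightarrow> bool" where
  "one_sided_scheme \<epsilon> n m S \<longleftrightarrow>
     (\<forall>A. storable n m A \<longrightarrow> (\<forall>x\<in>{1..m}.
        (\<forall>r. length r = ncoins S \<longrightarrow> probe S x (cached S A) r < length (storage S A)) \<and>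
        (x \<in> A \<longrightarrow> measure_pmf.prob (coins S) {r. query S A x r} = 1) \<and>
        (x \<notin> A \<longrightarrow> measure_pmf.prob (coins S) {r. query S A x r} < \<epsilon>)))"

text \<open>Running time is measured in a register machine with the logarithmic cost criterion of
  Aho, Hopcroft and Ullman, presented as a structured language: registers hold natural numbers,
  and every instruction and every loop or branch test costs one plus the binary lengths of the
  numbers involved. As a product is no longer than its factors together, this model and
  multitape Turing machines simulate each other with polynomial overhead. Subtraction is
  truncated and division by zero yields zero.\<close>

datatype arith_op = Plus | Minus | Times | Divide

fun arith :: "arith_op \<Rightarrow> nat \<Rightarrow> nat \<Rightarrow> nat" where
  "arith Plus a b = a + b"
| "arith Minus a b = a - b"
| "arith Times a b = a * b"
| "arith Divide a b = a div b"

datatype com =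
    Const nat nat                   (* target register, constant *)
  | Op arith_op nat nat nat         (* target register, operand registers *)
  | Seq com com
  | IfNZ nat com com
  | WhileNZ nat com

type_synonym store = "nat \<Rightarrow> nat"

definition size2 :: "nat \<Rightarrow> nat" where
  "size2 k = floorlog 2 k"

inductive exec :: "com \<Rightarrow> store \<Rightarrow> nat \<Rightarrow> store \<Rightarrow> bool" where
  Const: "exec (Const d k) s (1 + size2 k) (s(d := k))"
| Op: "c = arith f (s a) (s b) \<Longrightarrow>
    exec (Op f d a b) s (1 + size2 (s a) + size2 (s b) + size2 c) (s(d := c))"
| Seq: "exec P s t s' \<Longrightarrow> exec Q s' u s'' \<Longrightarrow> exec (Seq P Q) s (t + u) s''"
| IfTrue: "s a \<noteq> 0 \<Longrightarrow> exec P s t s' \<Longrightarrow> exec (IfNZ a P Q) s (1 + size2 (s a) + t) s'"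
| IfFalse: "s a = 0 \<Longrightarrow> exec Q s t s' \<Longrightarrow> exec (IfNZ a P Q) s (1 + size2 (s a) + t) s'"
| WhileTrue: "s a \<noteq> 0 \<Longrightarrow> exec P s t s' \<Longrightarrow> exec (WhileNZ a P) s' u s'' \<Longrightarrow>
    exec (WhileNZ a P) s (1 + size2 (s a) + t + u) s''"
| WhileFalse: "s a = 0 \<Longrightarrow> exec (WhileNZ a P) s (1 + size2 (s a)) s"

text \<open>A word is passed as the number whose binary digits, least significant first, are the word
  followed by a 1. This end marker makes the encoding injective.\<close>

definition word_code :: "bool list \<Rightarrow> nat" where
  "word_code w = horner_sum of_bool 2 (w @ [True])"

definition input_store :: "nat \<Rightarrow> bool list \<Rightarrow> bool list \<Rightarrow> store" where
  "input_store x C r = (\<lambda>_. 0)(0 := x, 1 := word_code C, 2 := word_code r)"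

definition computes_within ::
    "com \<Rightarrow> nat \<Rightarrow> bool list \<Rightarrow> bool list \<Rightarrow> nat \<Rightarrow> real \<Rightarrow> bool" where
  "computes_within P x C r y T \<longleftrightarrow>
     (\<exists>t s'. exec P (input_store x C r) t s' \<and> s' 0 = y \<and> real t \<le> T)"

end

theory Submission imports Defs "HOL-Library.Nat_Bijection" begin

text \<open>The storage consists of \<open>d = 2 ^ t\<close> blocks of \<open>s = O(n)\<close> bits, with \<open>d\<close> of order
  \<open>log m\<close>. Block \<open>i\<close> is addressed by a multiply-shift hash function with multiplier \<open>b i\<close>, and
  precisely the cells hit by elements of \<open>A\<close> are set to 1. The cached word holds \<open>s\<close> and the
  multipliers; the coins select a block. For fixed \<open>A\<close> and \<open>x \<notin> A\<close> a random multiplier makes \<open>x\<close>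
  collide with \<open>A\<close> with probability at most \<open>5 * n / s = 4 powr - k\<close>. Choosing the multipliers one
  after another so that \<open>\<Sum>x. 4 ^ (k * collisions x)\<close> at most doubles at each step keeps that sum
  at most \<open>m * 2 ^ d < 4 ^ d\<close>, so every \<open>x \<notin> A\<close> collides in fewer than \<open>d / k\<close> blocks.\<close>

section \<open>Words as numbers\<close>

lemma word_code_Nil: "word_code [] = 1"
  by (simp add: word_code_def)

lemma word_code_Cons: "word_code (b # w) = of_bool b + 2 * word_code w"
  by (simp add: word_code_def)

lemma word_code_ge: "2 ^ length w \<le> word_code w"
  by (induction w) (auto simp: word_code_Nil word_code_Cons)

lemma word_code_less: "word_code w < 2 ^ Suc (length w)"
  by (induction w) (auto simp: word_code_Nil word_code_Cons)

text \<open>Distinct coin words thereby address distinct blocks, so bad coins can be counted as bad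
  block numbers.\<close>

lemma word_code_inject_length:
  "length v = length w \<Longrightarrow> word_code v = word_code w \<Longrightarrow> v = w"
proof (induction v w rule: list_induct2)
  case (Cons a v b w)
  have "a = b"
    using arg_cong[OF Cons.prems, of even] by (cases a; cases b) (simp_all add: word_code_Cons)
  then show ?case using Cons by (simp add: word_code_Cons)
qed simp

lemma word_code_surj:
  assumes "c < 2 ^ l"
  shows "\<exists>w. length w = l \<and> word_code w = 2 ^ l + c"
  using assms
proof (induction l arbitrary: c)
  case (Suc l)
  then obtain w where "length w = l" "word_code w = 2 ^ l + c div 2"
    by (metis less_mult_imp_div_less power_Suc2)
  then have "length (odd c # w) = Suc l" "word_code (odd c # w) = 2 ^ Suc l + c"
    by (auto simp: word_code_Cons)
  then show ?case by blast
qed (simp add: word_code_Nil)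

section \<open>Multiply-shift hashing and its collision count\<close>

text \<open>The residue \<open>a * x mod N\<close>, read as a fraction of \<open>N\<close>, is
  scaled to the range below \<open>s\<close>, so the table size \<open>s\<close> need not be a power
  of two.\<close>

definition bucket :: "nat \<Rightarrow> nat \<Rightarrow> nat \<Rightarrow> nat \<Rightarrow> nat" where
  "bucket s N a x = (a * x mod N) * s div N"

lemma bucket_less: "s > 0 \<Longrightarrow> N > 0 \<Longrightarrow> bucket s N a x < s"
  unfolding bucket_def by (simp add: div_less_iff_less_mult mult.commute)

text \<open>Allows a multiplier to be read from the cached word with all higher digits still
  attached.\<close>

lemma bucket_mod: "bucket s N (a mod N) x = bucket s N a x"
  by (simp add: bucket_def mod_mult_left_eq)

text \<open>The products \<open>a * z\<close> are spaced by multiples of \<open>z\<close> and lie in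
  a window of width \<open>2 * N / s\<close>, so comparing the least and greatest \<open>a\<close>
  suffices. The summand \<open>s * z\<close> is the fencepost term.\<close>

lemma card_near_multiples:
  fixes z s :: nat and b N :: int
  assumes "z > 0" "finite Q" and near: "\<And>a. a \<in> Q \<Longrightarrow> \<bar>int a * int z - b\<bar> * int s < N" and "N \<ge> 0"
  shows "int s * int z * int (card Q) \<le> 2 * N + int s * int z"
proof (cases "Q = {}")
  case True
  then show ?thesis using assms by simp
next
  case False
  define l u where "l = Min Q" and "u = Max Q"
  have lu: "l \<in> Q" "u \<in> Q" "l \<le> u" "Q \<subseteq> {l..u}"
    using \<open>finite Q\<close> False by (auto simp: l_def u_def)
  have "card Q \<le> u - l + 1"
    using card_mono[OF _ lu(4)] lu(3) by simp
  then have "int (card Q) \<le> int u - int l + 1"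
    using lu(3) by linarith
  then have "int s * int z * int (card Q) \<le> int s * int z * (int u - int l + 1)"
    by (intro mult_left_mono) auto
  also have "\<dots> = (int u * int z - b) * int s - (int l * int z - b) * int s + int s * int z"
    by (simp add: algebra_simps)
  also have "\<dots> \<le> \<bar>int u * int z - b\<bar> * int s + \<bar>int l * int z - b\<bar> * int s + int s * int z"
  proof -
    have "(int u * int z - b) * int s \<le> \<bar>int u * int z - b\<bar> * int s"
      "- (int l * int z - b) * int s \<le> \<bar>int l * int z - b\<bar> * int s"
      by (intro mult_right_mono; simp)+
    then show ?thesis by linarith
  qed
  also have "\<dots> \<le> 2 * N + int s * int z"
    using near[OF lu(1)] near[OF lu(2)] by linarith
  finally show ?thesis .
qed

text \<open>A collision forces \<open>a * (x - y)\<close> to lie within \<open>N / s\<close> of a multiple \<open>q * N\<close>. As \<open>a\<close> runs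
  below \<open>N\<close> only \<open>x - y + 1\<close> values of \<open>q\<close> occur, each for about \<open>2 * N / (s * (x - y))\<close>
  multipliers \<open>a\<close>.\<close>

lemma bucket_collision_less:
  assumes "y < x" "x \<le> m" "m * s \<le> N" "N > 0" "y > 0"
  shows "s * card {a \<in> {..<N}. bucket s N a x = bucket s N a y} \<le> 5 * N"
proof -
  define z where "z = x - y"
  define E where "E = {a \<in> {..<N}. bucket s N a x = bucket s N a y}"
  define Q where "Q q = {a \<in> {..<N}. \<bar>int a * int z - int q * int N\<bar> * int s < int N}" for q
  have z: "z > 0" "z \<le> m" "int z = int x - int y" using assms by (auto simp: z_def)
  have "E \<subseteq> (\<Union>q\<in>{..z}. Q q)"
  proof
    fix a assume "a \<in> E"
    then have a: "a < N" and eq: "bucket s N a x = bucket s N a y" by (auto simp: E_def)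
    define u v where "u = a * x mod N" and "v = a * y mod N"
    \<comment> \<open>The difference of the two quotients is the multiple of \<open>N\<close> that
      \<open>a * z\<close> is close to; \<open>y < x\<close> keeps the truncated subtraction
      exact.\<close>
    define q where "q = a * x div N - a * y div N"
    have le: "a * y div N \<le> a * x div N" using assms by (simp add: div_le_mono)
    have u: "u < N" "v < N" using assms by (auto simp: u_def v_def)
    have ax: "int a * int x = int (a * x div N) * int N + int u"
      unfolding u_def by (metis div_mult_mod_eq of_nat_add of_nat_mult)
    have ay: "int a * int y = int (a * y div N) * int N + int v"
      unfolding v_def by (metis div_mult_mod_eq of_nat_add of_nat_mult)
    have diff: "int a * int z - int q * int N = int u - int v"
      using ax ay le by (simp add: z(3) q_def of_nat_diff algebra_simps)
    have "int a * int z \<le> int N * int z" using a by (intro mult_right_mono) auto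
    then have "int q * int N < (int z + 1) * int N"
      using diff u by (simp add: algebra_simps)
    then have "q \<le> z" using assms(4) by (simp add: mult_less_cancel_right)
    \<comment> \<open>Equal quotients by \<open>N\<close> leave only the remainders to
      differ.\<close>
    have "\<bar>int u * int s - int v * int s\<bar> < int N"
    proof -
      have "u * s div N = v * s div N" using eq by (simp add: bucket_def u_def v_def)
      then have "\<bar>int (u * s mod N) - int (v * s mod N)\<bar> = \<bar>int u * int s - int v * int s\<bar>"
        by (metis (no_types, lifting) add_diff_cancel_left div_mult_mod_eq of_nat_add of_nat_mult)
      moreover have "u * s mod N < N" "v * s mod N < N" using assms(4) by auto
      ultimately show ?thesis by linarith
    qed
    then have "\<bar>int u - int v\<bar> * int s < int N"
      by (metis abs_mult abs_of_nat left_diff_distrib)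
    then have "a \<in> Q q" using a diff by (simp add: Q_def)
    then show "a \<in> (\<Union>q\<in>{..z}. Q q)" using \<open>q \<le> z\<close> by blast
  qed
  then have "card E \<le> card (\<Union>q\<in>{..z}. Q q)"
    by (intro card_mono) (auto simp: Q_def)
  also have "\<dots> \<le> (\<Sum>q\<in>{..z}. card (Q q))"
    by (rule card_UN_le) simp
  finally have "s * z * card E \<le> (\<Sum>q\<in>{..z}. s * z * card (Q q))"
    by (metis mult_le_mono2 sum_distrib_left)
  also have "\<dots> \<le> (\<Sum>q\<in>{..z}. 2 * N + s * z)"
  proof (rule sum_mono)
    fix q
    have "int s * int z * int (card (Q q)) \<le> 2 * int N + int s * int z"
      by (rule card_near_multiples[where b = "int q * int N"]) (use z in \<open>auto simp: Q_def\<close>)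
    then show "s * z * card (Q q) \<le> 2 * N + s * z"
      by (metis (mono_tags, lifting) of_nat_add of_nat_le_iff of_nat_mult of_nat_numeral)
  qed
  also have "\<dots> = (z + 1) * (2 * N) + z * ((z + 1) * s)"
    by (simp add: algebra_simps)
  \<comment> \<open>The 5 is 4 + 1: \<open>z + 1 \<le> 2 * z\<close> gives \<open>4 * N\<close>, and
    the fencepost terms give one more \<open>N\<close>, because \<open>y > 0\<close> implies
    \<open>z + 1 \<le> m\<close> and \<open>m * s \<le> N\<close>.\<close>
  also have "\<dots> \<le> z * (4 * N) + z * ((z + 1) * s)"
    using z(1) by (cases z) auto
  also have "\<dots> \<le> z * (4 * N) + z * N"
  proof -
    have "(z + 1) * s \<le> m * s" using assms(1,2,5) by (intro mult_right_mono) (auto simp: z_def)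
    then show ?thesis using assms(3) by simp
  qed
  also have "\<dots> = z * (5 * N)" by simp
  finally have "z * (s * card E) \<le> z * (5 * N)" by (simp add: ac_simps)
  then show ?thesis using z(1) by (simp add: E_def)
qed

lemma bucket_collision:
  assumes "x \<in> {1..m}" "y \<in> {1..m}" "x \<noteq> y" "m * s \<le> N" "N > 0"
  shows "s * card {a \<in> {..<N}. bucket s N a x = bucket s N a y} \<le> 5 * N"
proof (cases "y < x")
  case True
  then show ?thesis using bucket_collision_less assms by auto
next
  case False
  then have "s * card {a \<in> {..<N}. bucket s N a y = bucket s N a x} \<le> 5 * N"
    using assms by (intro bucket_collision_less) auto
  then show ?thesis by (simp add: eq_commute)
qed

section \<open>Derandomized choice of hash functions\<close>

text \<open>Method of conditional expectations. For uniformly random \<open>a\<close> in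
  \<open>H j\<close> the weight of \<open>x\<close> is multiplied by \<open>c\<close> if
  \<open>bad j a x\<close> and kept otherwise; as \<open>c\<close> times the probability of
  \<open>bad\<close> is at most 1, its mean at most doubles. Hence some \<open>a\<close> at most
  doubles the sum over \<open>X\<close>.\<close>

lemma greedy_choice:
  fixes bad :: "'i \<Rightarrow> 'a \<Rightarrow> 'x \<Rightarrow> bool" and c :: nat
  assumes "finite I" "finite X"
    and H: "\<And>i. i \<in> I \<Longrightarrow> finite (H i) \<and> H i \<noteq> {}"
    and rare: "\<And>i x. i \<in> I \<Longrightarrow> x \<in> X \<Longrightarrow> c * card {a \<in> H i. bad i a x} \<le> card (H i)"
  shows "\<exists>f. (\<forall>i\<in>I. f i \<in> H i) \<and>
    (\<Sum>x\<in>X. c ^ card {i \<in> I. bad i (f i) x}) \<le> card X * 2 ^ card I"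
  using assms(1) H rare
proof (induction I)
  case (insert j I)
  then obtain f where f: "\<forall>i\<in>I. f i \<in> H i"
    "(\<Sum>x\<in>X. c ^ card {i \<in> I. bad i (f i) x}) \<le> card X * 2 ^ card I"
    by auto
  define w where "w x = c ^ card {i \<in> I. bad i (f i) x}" for x
  define v where "v a x = w x * (if bad j a x then c else 1)" for a x
  have Hj: "finite (H j)" "H j \<noteq> {}" using insert.prems by auto
  have "\<exists>a\<in>H j. (\<Sum>x\<in>X. v a x) \<le> 2 * (\<Sum>x\<in>X. w x)"
  proof (rule ccontr)
    assume "\<not> ?thesis"
    then have "(\<Sum>a\<in>H j. 2 * (\<Sum>x\<in>X. w x)) < (\<Sum>a\<in>H j. \<Sum>x\<in>X. v a x)"
      using Hj by (intro sum_strict_mono) auto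
    also have "\<dots> = (\<Sum>x\<in>X. \<Sum>a\<in>H j. v a x)"
      by (rule sum.swap)
    also have "\<dots> \<le> (\<Sum>x\<in>X. w x * (2 * card (H j)))"
    proof (rule sum_mono)
      fix x assume "x \<in> X"
      have "(\<Sum>a\<in>H j. v a x) = w x * (\<Sum>a\<in>H j. if bad j a x then c else 1)"
        by (simp add: v_def sum_distrib_left)
      also have "(\<Sum>a\<in>H j. if bad j a x then c else 1) \<le> (\<Sum>a\<in>H j. (if bad j a x then c else 0) + 1)"
        by (rule sum_mono) auto
      also have "\<dots> = c * card {a \<in> H j. bad j a x} + card (H j)"
        using Hj(1) by (simp add: sum.distrib sum.If_cases Int_def mult.commute del: One_nat_def)
      also have "\<dots> \<le> 2 * card (H j)"
        using insert.prems(2)[of j x] \<open>x \<in> X\<close> by simp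
      finally show "(\<Sum>a\<in>H j. v a x) \<le> w x * (2 * card (H j))" by simp
    qed
    finally show False by (simp add: sum_distrib_right sum_distrib_left algebra_simps)
  qed
  then obtain a where a: "a \<in> H j" "(\<Sum>x\<in>X. v a x) \<le> 2 * (\<Sum>x\<in>X. w x)" by blast
  have "c ^ card {i \<in> insert j I. bad i ((f(j := a)) i) x} = v a x" for x
  proof -
    have "{i \<in> insert j I. bad i ((f(j := a)) i) x} =
        (if bad j a x then insert j {i \<in> I. bad i (f i) x} else {i \<in> I. bad i (f i) x})"
      using insert.hyps by auto
    then show ?thesis using insert.hyps by (simp add: v_def w_def)
  qed
  then have "(\<Sum>x\<in>X. c ^ card {i \<in> insert j I. bad i ((f(j := a)) i) x}) \<le> card X * 2 ^ card (insert j I)"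
    using a(2) f(2) insert.hyps by (simp add: w_def)
  moreover have "\<forall>i\<in>insert j I. (f(j := a)) i \<in> H i" using f(1) a(1) by auto
  ultimately show ?case by blast
qed simp

section \<open>Packing the multipliers into the cached word\<close>

text \<open>Successive triangular numbers differ by \<open>Suc i\<close>, one more than the width of
  digit \<open>i\<close>, so a spare bit separates neighbouring digits.\<close>

lemma triangle_add_less: "i < e \<Longrightarrow> triangle i + i < triangle e"
proof (induction e)
  case (Suc e)
  then show ?case by (cases "i = e") auto
qed simp

text \<open>Digit \<open>i\<close> occupies the \<open>i\<close> bits from position \<open>triangle i\<close> on. A machine can locate it
  knowing \<open>i\<close> only, since \<open>2 ^ i\<close> and \<open>2 ^ triangle i\<close> arise together in a loop of \<open>i\<close> rounds. The
  blocks carry the numbers \<open>d, \<dots>, 2 * d - 1\<close>, so that the code of the coin word is the number of a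
  block, and the bits below \<open>triangle d\<close> are left for \<open>s\<close>.\<close>

definition digit :: "nat \<Rightarrow> nat \<Rightarrow> nat" where
  "digit c i = c div 2 ^ triangle i mod 2 ^ i"

lemma digit_add:
  assumes "i < e"
  shows "digit (c + 2 ^ triangle e * b) i = digit c i"
proof -
  obtain l where "triangle e = triangle i + i + l"
    using less_imp_add_positive[OF triangle_add_less[OF assms]] by (elim exE conjE) metis
  then have "c + 2 ^ triangle e * b = c + 2 ^ triangle i * (2 ^ i * (2 ^ l * b))"
    by (simp only: power_add mult.assoc)
  moreover have "(c + 2 ^ triangle i * (2 ^ i * (2 ^ l * b))) div 2 ^ triangle i = 2 ^ i * (2 ^ l * b) + c div 2 ^ triangle i"
    by (rule div_mult_self2) simp
  ultimately show ?thesis unfolding digit_def by (simp only: mod_mult_self4)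
qed

lemma digit_top:
  assumes "c < 2 ^ triangle i" "b < 2 ^ i"
  shows "digit (c + 2 ^ triangle i * b) i = b"
proof -
  have "(c + 2 ^ triangle i * b) div 2 ^ triangle i = b + c div 2 ^ triangle i"
    by (rule div_mult_self2) simp
  then show ?thesis using assms by (simp add: digit_def)
qed

text \<open>The number is built from the low end: \<open>s\<close> comes first and each induction
  step puts one digit on top, disturbing nothing below.\<close>

lemma digits_exist:
  assumes "d \<le> e" "s < 2 ^ d" and b: "\<And>i. i \<in> {d..<e} \<Longrightarrow> b i < 2 ^ i"
  shows "\<exists>c < 2 ^ triangle e. c mod 2 ^ triangle d = s \<and> (\<forall>i\<in>{d..<e}. digit c i = b i)"
  using assms(1) b
proof (induction e rule: dec_induct)
  case base
  have "s < 2 ^ triangle d"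
    by (rule less_le_trans[OF assms(2)]) (cases d; simp)
  then show ?case by (intro exI[of _ s]) auto
next
  case (step e)
  then obtain c where c: "c < 2 ^ triangle e" "c mod 2 ^ triangle d = s" "\<forall>i\<in>{d..<e}. digit c i = b i"
    by auto
  have be: "b e < 2 ^ e" using step by auto
  define c' where "c' = c + 2 ^ triangle e * b e"
  have "c' < 2 ^ triangle e + 2 ^ triangle e * b e" using c(1) by (simp add: c'_def)
  also have "\<dots> = 2 ^ triangle e * (b e + 1)" by simp
  also have "\<dots> \<le> 2 ^ triangle e * 2 ^ e" using be by (intro mult_left_mono) auto
  also have "\<dots> \<le> 2 ^ triangle (Suc e)" by (simp add: power_add)
  finally have "c' < 2 ^ triangle (Suc e)" .
  moreover have "triangle d \<le> triangle e"
    using triangle_add_less[of d e] step(1) by (cases "d = e") auto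
  then obtain l where "triangle e = triangle d + l" using le_Suc_ex by blast
  then have "c' = c + 2 ^ triangle d * (2 ^ l * b e)" by (simp add: c'_def power_add mult.assoc)
  then have "c' mod 2 ^ triangle d = s" using c(2) by simp
  moreover have "digit c' i = b i" if "i \<in> {d..<Suc e}" for i
    using that c be digit_add[of i e c "b e"] digit_top[of c e "b e"] unfolding c'_def
    by (cases "i = e") auto
  ultimately show ?case by blast
qed

lemma triangle_double: "triangle (2 * d) = d * (2 * d + 1)"
  by (simp add: triangle_def)

text \<open>Ensures that reducing modulo \<open>2 ^ i\<close>, for any block number
  \<open>i\<close>, cuts off all digits and leaves \<open>s\<close>.\<close>

lemma le_triangle: "i < 2 * d \<Longrightarrow> i \<le> triangle d"
proof (induction d arbitrary: i)
  case (Suc d)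
  show ?case
  proof (cases "i < 2")
    case False
    then have "i - 2 \<le> triangle d" using Suc by auto
    with False Suc.prems show ?thesis by simp
  qed simp
qed simp

text \<open>The formula avoids \<open>d\<close>, which the machine is not told: \<open>s\<close> is
  recovered modulo \<open>2 ^ \<rho>\<close>, and block \<open>\<rho>\<close> starts at
  \<open>\<rho> * s\<close> instead of \<open>(\<rho> - d) * s\<close>, at the price of a factor of
  about two in storage.\<close>

definition position :: "nat \<Rightarrow> nat \<Rightarrow> nat \<Rightarrow> nat" where
  "position c \<rho> x =
    (let s = c mod 2 ^ \<rho> in \<rho> * s + bucket s (2 ^ \<rho>) (c div 2 ^ triangle \<rho>) x)"

lemma cache_exists:
  assumes "s < 2 ^ d" and b: "\<And>i. i \<in> {d..<2*d} \<Longrightarrow> b i < 2 ^ i"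
  shows "\<exists>w. length w = triangle (2 * d) \<and>
    (\<forall>i\<in>{d..<2*d}. \<forall>x. word_code w mod 2 ^ i = s \<and> position (word_code w) i x = i * s + bucket s (2 ^ i) (b i) x)"
proof -
  obtain c where c: "c < 2 ^ triangle (2*d)" "c mod 2 ^ triangle d = s" "\<forall>i\<in>{d..<2*d}. digit c i = b i"
    using digits_exist[of d "2*d" s b] assms by auto
  obtain w where w: "length w = triangle (2*d)" "word_code w = 2 ^ triangle (2*d) + c"
    using word_code_surj[OF c(1)] by auto
  have "word_code w mod 2 ^ i = s \<and> position (word_code w) i x = i * s + bucket s (2 ^ i) (b i) x"
    if i: "i \<in> {d..<2*d}" for i x
  proof -
    have "i \<le> triangle d" using i le_triangle by auto
    then have "2 ^ i dvd (2 ^ triangle d :: nat)" by (rule le_imp_power_dvd)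
    then have "c mod 2 ^ i = s mod 2 ^ i" using mod_mod_cancel[of "2 ^ i" "2 ^ triangle d" c] c(2) by simp
    also have "(2::nat) ^ d \<le> 2 ^ i" using i by simp
    then have "s mod 2 ^ i = s" using assms(1) by (meson mod_less less_le_trans)
    finally have "c mod 2 ^ i = s" .
    moreover have "2 ^ i dvd (2 ^ triangle (2*d) :: nat)"
      using triangle_add_less[of i "2*d"] i by (intro le_imp_power_dvd) auto
    ultimately have "word_code w mod 2 ^ i = s" unfolding w(2) by (auto simp: mult.commute elim!: dvdE)
    \<comment> \<open>The end marker acts as a digit 1 at place \<open>2 * d\<close>, above all
      multipliers.\<close>
    moreover have "digit (word_code w) i = b i"
      using digit_add[of i "2*d" c 1] c(3) i by (simp add: w(2) add.commute)
    then have "bucket s (2 ^ i) (word_code w div 2 ^ triangle i) x = bucket s (2 ^ i) (b i) x"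
      using bucket_mod[of s "2 ^ i" "word_code w div 2 ^ triangle i" x] by (simp add: digit_def)
    ultimately show ?thesis by (simp add: position_def)
  qed
  then show ?thesis using w(1) by blast
qed

section \<open>Multipliers with few collisions\<close>

text \<open>A union bound over the at most \<open>n\<close> elements of \<open>A\<close>, each
  colliding with \<open>x\<close> for at most \<open>5 * 2 ^ i / s\<close> multipliers, leaves a bad
  fraction of at most \<open>1 / 4 ^ k\<close>, as \<open>greedy_choice\<close> with
  \<open>c = 4 ^ k\<close> requires. A single term of the resulting sum then bounds the collisions
  of \<open>x\<close>.\<close>

lemma hash_exists:
  assumes A: "A \<subseteq> {1..m}" "card A \<le> n" and s: "s = 5 * 4 ^ k * n"
    and d: "m * s \<le> 2 ^ d" "m < 2 ^ d" "d > 0"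
  shows "\<exists>b. (\<forall>i\<in>{d..<2*d}. b i < 2 ^ i) \<and>
    (\<forall>x\<in>{1..m} - A. k * card {i \<in> {d..<2*d}. \<exists>y\<in>A. bucket s (2 ^ i) (b i) x = bucket s (2 ^ i) (b i) y} < d)"
proof -
  define bad where "bad i a x \<longleftrightarrow> (\<exists>y\<in>A. bucket s (2 ^ i) a x = bucket s (2 ^ i) a y)" for i a x
  have finA: "finite A" using A(1) finite_subset by blast
  have rare: "4 ^ k * card {a \<in> {..<2 ^ i}. bad i a x} \<le> card {..<2 ^ i :: nat}"
    if i: "i \<in> {d..<2*d}" and x: "x \<in> {1..m} - A" for i x
  proof (cases "A = {}")
    case True
    then show ?thesis by (simp add: bad_def)
  next
    case False
    then have n: "n > 0" using A(2) finA card_gt_0_iff by fastforce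
    define E where "E y = {a \<in> {..<2 ^ i}. bucket s (2 ^ i) a x = bucket s (2 ^ i) a y}" for y
    have N: "m * s \<le> 2 ^ i" using d(1) i by (meson atLeastLessThan_iff one_le_numeral order_trans power_increasing)
    have "{a \<in> {..<2 ^ i}. bad i a x} = (\<Union>y\<in>A. E y)" by (auto simp: bad_def E_def)
    then have "s * card {a \<in> {..<2 ^ i}. bad i a x} \<le> s * (\<Sum>y\<in>A. card (E y))"
      using finA by (simp add: card_UN_le)
    also have "\<dots> = (\<Sum>y\<in>A. s * card (E y))" by (rule sum_distrib_left)
    also have "\<dots> \<le> (\<Sum>y\<in>A. 5 * 2 ^ i)"
      unfolding E_def by (intro sum_mono bucket_collision[where m = m]) (use x A N in auto)
    also have "\<dots> \<le> n * (5 * 2 ^ i)" using A(2) by simp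
    finally have "(5 * n) * (4 ^ k * card {a \<in> {..<2 ^ i}. bad i a x}) \<le> (5 * n) * 2 ^ i"
      by (simp add: s ac_simps)
    then show ?thesis using n by simp
  qed
  have "\<exists>b. (\<forall>i\<in>{d..<2*d}. b i \<in> {..<2 ^ i}) \<and>
    (\<Sum>x\<in>{1..m} - A. (4 ^ k :: nat) ^ card {i \<in> {d..<2*d}. bad i (b i) x}) \<le> card ({1..m} - A) * 2 ^ card {d..<2*d}"
    using greedy_choice[where I = "{d..<2*d}" and X = "{1..m} - A" and H = "\<lambda>i. {..<2 ^ i}" and c = "4 ^ k" and bad = bad, OF _ _ _ rare]
    by (simp add: lessThan_empty_iff)
  then obtain b where b: "\<forall>i\<in>{d..<2*d}. b i \<in> {..<2 ^ i}"
    "(\<Sum>x\<in>{1..m} - A. (4 ^ k :: nat) ^ card {i \<in> {d..<2*d}. bad i (b i) x}) \<le> card ({1..m} - A) * 2 ^ card {d..<2*d}"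
    by blast
  have "k * card {i \<in> {d..<2*d}. bad i (b i) x} < d" if "x \<in> {1..m} - A" for x
  proof -
    have "(4 ^ k :: nat) ^ card {i \<in> {d..<2*d}. bad i (b i) x} \<le>
        (\<Sum>x\<in>{1..m} - A. (4 ^ k :: nat) ^ card {i \<in> {d..<2*d}. bad i (b i) x})"
      using that by (intro member_le_sum) auto
    also have "\<dots> \<le> card ({1..m} - A) * 2 ^ d" using b(2) by simp
    also have "\<dots> \<le> m * 2 ^ d"
      using card_mono[of "{1..m}" "{1..m} - A"] by (intro mult_right_mono) auto
    also have "\<dots> < 2 ^ d * 2 ^ d" using d(2) by simp
    also have "\<dots> = (4::nat) ^ d" unfolding power_mult_distrib[symmetric] by simp
    finally have "(4::nat) ^ (k * card {i \<in> {d..<2*d}. bad i (b i) x}) < 4 ^ d"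
      by (simp add: power_mult)
    then show ?thesis by simp
  qed
  then show ?thesis using b(1) unfolding bad_def by (intro exI[of _ b] conjI ballI) simp_all
qed

section \<open>The probe program and its running time\<close>

lemma size2_le: "k < 2 ^ M \<Longrightarrow> size2 k \<le> M"
  unfolding size2_def by (simp add: floorlog_le_iff)

definition exec_upto :: "com \<Rightarrow> store \<Rightarrow> nat \<Rightarrow> store \<Rightarrow> bool" where
  "exec_upto P s T s' \<longleftrightarrow> (\<exists>t \<le> T. exec P s t s')"

lemma exec_upto_Seq:
  "exec_upto P s T s' \<Longrightarrow> exec_upto Q s' U s'' \<Longrightarrow> exec_upto (Seq P Q) s (T + U) s''"
  unfolding exec_upto_def by (meson add_mono exec.Seq)

type_synonym instr = "arith_op \<times> nat \<times> nat \<times> nat"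

text \<open>\<open>com\<close> has no empty command, so the recursion ends at singletons and
  \<open>Const 0 0\<close> is a default.\<close>

fun block :: "instr list \<Rightarrow> com" where
  "block [] = Const 0 0"
| "block [(f, i, a, b)] = Op f i a b"
| "block ((f, i, a, b) # is) = Seq (Op f i a b) (block is)"

fun run :: "instr list \<Rightarrow> store \<Rightarrow> store" where
  "run [] s = s"
| "run ((f, i, a, b) # is) s = run is (s(i := arith f (s a) (s b)))"

text \<open>All operands and results having at most \<open>M\<close> bits, each instruction costs at
  most \<open>1 + 3 * M\<close>.\<close>

fun fits :: "nat \<Rightarrow> instr list \<Rightarrow> store \<Rightarrow> bool" where
  "fits M [] s \<longleftrightarrow> True"
| "fits M ((f, i, a, b) # is) s \<longleftrightarrow>
    s a < 2 ^ M \<and> s b < 2 ^ M \<and> arith f (s a) (s b) < 2 ^ M \<and> fits M is (s(i := arith f (s a) (s b)))"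

lemma exec_upto_Op:
  assumes "s a < 2 ^ M" "s b < 2 ^ M" "arith f (s a) (s b) < 2 ^ M"
  shows "exec_upto (Op f i a b) s (1 + 3 * M) (s(i := arith f (s a) (s b)))"
  unfolding exec_upto_def using assms[THEN size2_le] exec.Op[OF refl]
  by (intro exI[of _ "1 + size2 (s a) + size2 (s b) + size2 (arith f (s a) (s b))"]) auto

lemma exec_upto_block:
  assumes "is \<noteq> []" "fits M is s"
  shows "exec_upto (block is) s (length is * (1 + 3 * M)) (run is s)"
  using assms
proof (induction "is" arbitrary: s rule: list_nonempty_induct)
  case (single i)
  obtain f j a b where "i = (f, j, a, b)" by (cases i)
  with single show ?case using exec_upto_Op[of s a M b f j] by (simp add: fun_upd_def)
next
  case (cons i "is")
  obtain f j a b where i: "i = (f, j, a, b)" by (cases i)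
  have "block (i # is) = Seq (Op f j a b) (block is)"
    using cons.hyps i by (cases "is") auto
  moreover have "exec_upto (Op f j a b) s (1 + 3 * M) (s(j := arith f (s a) (s b)))"
    using cons.prems i by (intro exec_upto_Op) auto
  then have "exec_upto (Seq (Op f j a b) (block is)) s
      (1 + 3 * M + length is * (1 + 3 * M)) (run is (s(j := arith f (s a) (s b))))"
    using cons i by (intro exec_upto_Seq cons.IH) auto
  ultimately show ?case by (simp add: i algebra_simps)
qed

text \<open>Registers: 0 element and result, 1 cache code, 2 block number, 3 and 4 the powers
  \<open>2 ^ i\<close> and \<open>2 ^ triangle i\<close>, 5 the constant 1 (obtained by dividing the block number by
  itself), 6 loop counter, 7 initially 0 and later \<open>s\<close>, 8 scratch.\<close>

definition setup_block :: "instr list" where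
  "setup_block = [(Divide, 3, 2, 2), (Plus, 4, 3, 7), (Plus, 5, 3, 7), (Plus, 6, 2, 7)]"

definition power_block :: "instr list" where
  "power_block = [(Plus, 3, 3, 3), (Times, 4, 4, 3), (Minus, 6, 6, 5)]"

text \<open>Remainders are formed as \<open>u - u div T * T\<close>, there being no such
  instruction. In turn this yields \<open>s\<close>, the multiplier, the residue
  \<open>a * x mod 2 ^ \<rho>\<close>, its bucket, and the offset \<open>\<rho> * s\<close>.\<close>

definition position_block :: "instr list" where
  "position_block =
    [(Divide, 7, 1, 3), (Times, 7, 7, 3), (Minus, 7, 1, 7),
     (Divide, 1, 1, 4), (Times, 0, 1, 0),
     (Divide, 8, 0, 3), (Times, 8, 8, 3), (Minus, 0, 0, 8),
     (Times, 0, 0, 7), (Divide, 0, 0, 3),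
     (Times, 8, 2, 7), (Plus, 0, 8, 0)]"

definition probe_program :: com where
  "probe_program = Seq (block setup_block) (Seq (WhileNZ 6 (block power_block)) (block position_block))"

text \<open>Invariant: after \<open>i\<close> rounds registers 3 and 4 hold \<open>2 ^ i\<close> and
  \<open>2 ^ triangle i\<close>, with \<open>j\<close> rounds left. Multiplying by the already
  doubled power matches \<open>triangle (Suc i) = triangle i + Suc i\<close>. A round costs one
  test, \<open>1 + M\<close>, and three instructions.\<close>

lemma exec_upto_power_loop:
  assumes "s 3 = 2 ^ i" "s 4 = 2 ^ triangle i" "s 5 = 1" "s 6 = j" "i + j < M" "triangle (i + j) < M"
  shows "exec_upto (WhileNZ 6 (block power_block)) s (j * (4 + 10 * M) + (1 + M))
    (s(3 := 2 ^ (i + j), 4 := 2 ^ triangle (i + j), 6 := 0))"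
  using assms
proof (induction j arbitrary: i s)
  case 0
  then have "s(3 := 2 ^ (i + 0), 4 := 2 ^ triangle (i + 0), 6 := 0) = s"
    by (auto simp: fun_eq_iff)
  moreover have "exec (WhileNZ 6 (block power_block)) s (1 + size2 (s 6)) s"
    by (rule exec.WhileFalse) (use 0 in simp)
  moreover have "size2 (s 6) \<le> M" by (rule size2_le) (use 0 in simp)
  ultimately show ?case unfolding exec_upto_def by (intro exI[of _ "1 + size2 (s 6)"]) auto
next
  case (Suc j)
  define s' where "s' = run power_block s"
  have mono: "triangle i + i < triangle (i + Suc j)" "triangle (Suc i) \<le> triangle (i + Suc j)"
    using triangle_add_less[of i "i + Suc j"] triangle_add_less[of "Suc i" "i + Suc j"]
    by (cases j; simp)+
  have lt: "2 ^ l < (2::nat) ^ M" if "l < M" for l using that by simp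
  have j: "s 6 < 2 ^ M"
    unfolding Suc.prems(4) by (rule less_trans[OF less_exp lt]) (use Suc.prems(5) in simp)
  have fit: "fits M power_block s"
    using Suc.prems j mono lt[of i] lt[of "Suc i"] lt[of "triangle i"] lt[of "triangle (Suc i)"]
    by (simp add: power_block_def power_add mult_2 algebra_simps)
  have s': "s' = s(3 := 2 ^ Suc i, 4 := 2 ^ triangle (Suc i), 6 := j)"
    using Suc.prems by (simp add: s'_def power_block_def power_add mult_2 fun_eq_iff algebra_simps)
  obtain t where t: "t \<le> 3 * (1 + 3 * M)" "exec (block power_block) s t s'"
  proof -
    have "exec_upto (block power_block) s (length power_block * (1 + 3 * M)) s'"
      unfolding s'_def by (intro exec_upto_block fit) (simp add: power_block_def)
    moreover have "length power_block = 3" by (simp add: power_block_def)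
    ultimately show ?thesis using that unfolding exec_upto_def by metis
  qed
  have "exec_upto (WhileNZ 6 (block power_block)) s' (j * (4 + 10 * M) + (1 + M))
      (s'(3 := 2 ^ (Suc i + j), 4 := 2 ^ triangle (Suc i + j), 6 := 0))"
    by (rule Suc.IH) (use Suc.prems in \<open>auto simp: s'\<close>)
  then obtain u where u: "u \<le> j * (4 + 10 * M) + (1 + M)"
    "exec (WhileNZ 6 (block power_block)) s' u (s'(3 := 2 ^ (Suc i + j), 4 := 2 ^ triangle (Suc i + j), 6 := 0))"
    unfolding exec_upto_def by blast
  have eq: "s'(3 := 2 ^ (Suc i + j), 4 := 2 ^ triangle (Suc i + j), 6 := 0) =
      s(3 := 2 ^ (i + Suc j), 4 := 2 ^ triangle (i + Suc j), 6 := 0)"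
    by (auto simp: s' fun_eq_iff)
  have "exec (WhileNZ 6 (block power_block)) s (1 + size2 (s 6) + t + u)
      (s(3 := 2 ^ (i + Suc j), 4 := 2 ^ triangle (i + Suc j), 6 := 0))"
    using exec.WhileTrue[OF _ t(2) u(2)] Suc.prems(4) unfolding eq by simp
  moreover have "1 + size2 (s 6) + t + u \<le> Suc j * (4 + 10 * M) + (1 + M)"
    using t(1) u(1) size2_le[OF j] by simp
  ultimately show ?case unfolding exec_upto_def by blast
qed

lemma probe_program_correct:
  assumes "x < 2 ^ d" "word_code w < 2 ^ (2 * d\<^sup>2 + d + 1)" "word_code r = \<rho>" "0 < \<rho>" "\<rho> < 2 * d"
  shows "computes_within probe_program x w r (position (word_code w) \<rho> x) (2000 * real d ^ 3)"
proof -
  \<comment> \<open>A common bound on bit lengths. The product of multiplier and element is below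
    \<open>2 ^ (2 * d\<^sup>2 + 2 * d + 1)\<close>, and \<open>d \<ge> 1\<close>.\<close>
  define M where "M = 8 * d\<^sup>2"
  define c where "c = word_code w"
  define s0 where "s0 = input_store x w r"
  define s1 where "s1 = run setup_block s0"
  define s2 where "s2 = s1(3 := 2 ^ \<rho>, 4 := 2 ^ triangle \<rho>, 6 := 0)"
  have d: "d > 0" "d \<le> d\<^sup>2" "1 \<le> d\<^sup>2" using assms by (auto simp: power2_eq_square)
  have lt: "2 ^ l < (2::nat) ^ M" if "l < M" for l using that by simp
  have tri: "triangle \<rho> < 2 * d\<^sup>2 + d"
    using triangle_add_less[OF assms(5)] triangle_double[of d] by (simp add: power2_eq_square algebra_simps)
  have s0: "s0 = (\<lambda>_. 0)(0 := x, 1 := c, 2 := \<rho>)"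
    using assms(3) by (simp add: s0_def input_store_def c_def)
  have s1: "s1 = s0(3 := 1, 4 := 1, 5 := 1, 6 := \<rho>)"
    using assms(4) by (auto simp: s1_def setup_block_def s0 fun_eq_iff)
  have bnd: "x < 2 ^ M" "c < 2 ^ M" "\<rho> < 2 ^ M" "2 ^ \<rho> < (2::nat) ^ M" "2 ^ triangle \<rho> < (2::nat) ^ M" "1 < (2::nat) ^ M"
  proof -
    show "x < 2 ^ M" by (rule less_trans[OF assms(1) lt]) (use d in \<open>simp add: M_def\<close>)
    show "c < 2 ^ M" unfolding c_def by (rule less_trans[OF assms(2) lt]) (use d in \<open>simp add: M_def\<close>)
    show *: "2 ^ \<rho> < (2::nat) ^ M" using assms(5) d by (intro lt) (simp add: M_def)
    show "\<rho> < 2 ^ M" using * less_exp[of \<rho>] by linarith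
    show "2 ^ triangle \<rho> < (2::nat) ^ M" using tri d by (intro lt) (simp add: M_def)
    show "1 < (2::nat) ^ M" using lt[of 0] d by (simp add: M_def)
  qed
  have e1: "exec_upto (block setup_block) s0 (4 * (1 + 3 * M)) s1"
  proof -
    have "fits M setup_block s0"
      using bnd assms(4) by (simp add: setup_block_def s0)
    then have "exec_upto (block setup_block) s0 (length setup_block * (1 + 3 * M)) s1"
      unfolding s1_def by (intro exec_upto_block) (simp_all add: setup_block_def)
    moreover have "length setup_block = 4" by (simp add: setup_block_def)
    ultimately show ?thesis by simp
  qed
  \<comment> \<open>The setup leaves 1 in registers 3 and 4, the powers for
    \<open>i = 0\<close>.\<close>
  have e2: "exec_upto (WhileNZ 6 (block power_block)) s1 (\<rho> * (4 + 10 * M) + (1 + M)) s2"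
    unfolding s2_def using exec_upto_power_loop[of s1 0 \<rho> M] assms(5) tri d by (simp add: s1 M_def)
  define T where "T = (2::nat) ^ \<rho>"
  define S where "S = c mod T"
  define a where "a = c div 2 ^ triangle \<rho>"
  define y where "y = a * x"
  have S: "S < T" "c div T * T \<le> c" "c - c div T * T = S"
    by (auto simp: S_def T_def minus_div_mult_eq_mod)
  have a: "a \<le> c" by (simp add: a_def)
  have "y < 2 ^ (2 * d\<^sup>2 + d + 1) * 2 ^ d"
    unfolding y_def using a assms(1,2) by (intro mult_strict_mono) (auto simp: c_def)
  also have "\<dots> < 2 ^ M" unfolding power_add[symmetric] using d by (intro lt) (simp add: M_def)
  finally have yM: "y < 2 ^ M" .
  have y: "y div T * T \<le> y" "y - y div T * T = y mod T" "y mod T < T" "y div T \<le> y"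
    by (auto simp: T_def minus_div_mult_eq_mod)
  have T2: "T * T < 2 ^ M" unfolding T_def power_add[symmetric] using d assms(5) by (intro lt) (simp add: M_def)
  have yS: "y mod T * S \<le> T * T" using S y by (intro mult_mono) auto
  \<comment> \<open>The bucket is at most \<open>S\<close>, so the sum is at most
    \<open>(\<rho> + 1) * S\<close>, and \<open>\<rho> + 1 \<le> 2 ^ \<rho>\<close>.\<close>
  have rS: "\<rho> * S + y mod T * S div T < 2 ^ M"
  proof -
    have "y mod T * S div T \<le> T * S div T" using y(3) by (intro div_le_mono mult_right_mono) auto
    also have "\<dots> = S" by (simp add: T_def)
    finally have "\<rho> * S + y mod T * S div T \<le> (\<rho> + 1) * S" by simp
    also have "\<dots> \<le> T * T" using S(1) Suc_leI[OF less_exp[of \<rho>]] by (intro mult_mono) (simp_all add: T_def)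
    finally show ?thesis using T2 by linarith
  qed
  have s2: "s2 = (\<lambda>_. 0)(0 := x, 1 := c, 2 := \<rho>, 3 := T, 4 := 2 ^ triangle \<rho>, 5 := 1)"
    by (auto simp: s2_def s1 s0 T_def fun_eq_iff)
  have q: "c div T < 2 ^ M" "c div T * T < 2 ^ M" "y div T < 2 ^ M" "y div T * T < 2 ^ M"
    using bnd(2) yM S(2) y(1) div_le_dividend[of c T] div_le_dividend[of y T] by linarith+
  have fit: "fits M position_block s2"
    using bnd S a yM y T2 yS rS 
    by (simp add: position_block_def s2 q le_less_trans[OF a] le_less_trans[OF yS] flip: a_def y_def T_def)
  have res: "run position_block s2 0 = position c \<rho> x"
    by (simp add: position_block_def s2 S y position_def bucket_def flip: a_def y_def T_def S_def)
  have e3: "exec_upto (block position_block) s2 (12 * (1 + 3 * M)) (run position_block s2)"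
  proof -
    have "exec_upto (block position_block) s2 (length position_block * (1 + 3 * M)) (run position_block s2)"
      by (intro exec_upto_block fit) (simp add: position_block_def)
    moreover have "length position_block = 12" by (simp add: position_block_def)
    ultimately show ?thesis by simp
  qed
  \<comment> \<open>Fewer than \<open>2 * d\<close> rounds of cost at most
    \<open>84 * d\<^sup>2\<close> dominate; the rest is quadratic in \<open>d\<close> and fits amply
    under 2000.\<close>
  have time: "4 * (1 + 3 * M) + ((\<rho> * (4 + 10 * M) + (1 + M)) + 12 * (1 + 3 * M)) \<le> 2000 * d ^ 3"
  proof -
    have "\<rho> * (4 + 10 * M) \<le> 2 * d * (84 * d\<^sup>2)"
      using assms(5) d by (intro mult_mono) (auto simp: M_def)
    also have "\<dots> = 168 * d ^ 3" by (simp add: power2_eq_square power3_eq_cube)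
    finally have "\<rho> * (4 + 10 * M) \<le> 168 * d ^ 3" .
    moreover have "d\<^sup>2 \<le> d ^ 3" using d by (intro power_increasing) auto
    moreover have "4 * (1 + 3 * M) + (l + (1 + M) + 12 * (1 + 3 * M)) \<le> 2000 * h"
      if "l \<le> 168 * h" "q \<le> h" "1 \<le> q" "M = 8 * q" for l q h using that by simp
    ultimately show ?thesis using d(3) M_def by blast
  qed
  have "exec_upto probe_program s0 (2000 * d ^ 3) (run position_block s2)"
    using exec_upto_Seq[OF e1 exec_upto_Seq[OF e2 e3]] time
    unfolding exec_upto_def probe_program_def by (meson order_trans)
  then obtain t where "t \<le> 2000 * d ^ 3" "exec probe_program s0 t (run position_block s2)"
    unfolding exec_upto_def by blast
  then show ?thesis unfolding computes_within_def s0_def c_def[symmetric]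
    using res by (intro exI[of _ t] exI[of _ "run position_block s2"]) (auto simp flip: of_nat_le_iff[where 'a=real])
qed

section \<open>The scheme and its error\<close>

lemma bucket_le: "N > 0 \<Longrightarrow> bucket s N a x \<le> s"
  using bucket_less[of s N a x] by (cases "s = 0") (auto simp: bucket_def)

text \<open>Blocks occupy disjoint intervals of \<open>s\<close> cells, so a cell probed for
  \<open>x\<close> in block \<open>i\<close> can be set only by an element hashed in the same block.
  Collisions of positions thus reduce to those of buckets.\<close>

lemma cached_word_exists:
  assumes A: "A \<subseteq> {1..m}" "card A \<le> n" and s: "s = 5 * 4 ^ k * n"
    and d: "m * s \<le> 2 ^ d" "m < 2 ^ d" "s < 2 ^ d" "d > 0"
  shows "\<exists>w. length w = triangle (2 * d) \<and>
    (\<forall>i\<in>{d..<2*d}. \<forall>x. position (word_code w) i x \<le> 2 * d * s) \<and>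
    (\<forall>x\<in>{1..m} - A. k * card {i \<in> {d..<2*d}. \<exists>j\<in>{d..<2*d}. \<exists>y\<in>A.
        position (word_code w) i x = position (word_code w) j y} < d)"
proof -
  obtain b where b: "\<forall>i\<in>{d..<2*d}. b i < 2 ^ i"
    "\<forall>x\<in>{1..m} - A. k * card {i \<in> {d..<2*d}. \<exists>y\<in>A. bucket s (2 ^ i) (b i) x = bucket s (2 ^ i) (b i) y} < d"
    using hash_exists[OF A s d(1,2,4)] by blast
  obtain w where w: "length w = triangle (2 * d)"
    "\<And>i x. i \<in> {d..<2*d} \<Longrightarrow> position (word_code w) i x = i * s + bucket s (2 ^ i) (b i) x"
    using cache_exists[OF d(3), of b] b(1) by blast
  have "position (word_code w) i x \<le> 2 * d * s" if "i \<in> {d..<2*d}" for i x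
  proof -
    have "i * s + bucket s (2 ^ i) (b i) x \<le> (i + 1) * s"
      using bucket_le[of "2 ^ i" s "b i" x] by simp
    also have "\<dots> \<le> 2 * d * s" using that by (intro mult_right_mono) auto
    finally show ?thesis using w(2) that by simp
  qed
  moreover have "k * card {i \<in> {d..<2*d}. \<exists>j\<in>{d..<2*d}. \<exists>y\<in>A.
      position (word_code w) i x = position (word_code w) j y} < d" if x: "x \<in> {1..m} - A" for x
  proof -
    have "i = j \<and> bucket s (2 ^ i) (b i) x = bucket s (2 ^ j) (b j) y"
      if "i \<in> {d..<2*d}" "j \<in> {d..<2*d}" "y \<in> A" and
        eq: "position (word_code w) i x = position (word_code w) j y" for i j y
    proof -
      have "finite A" using A(1) finite_subset by blast
      then have "n > 0" using A(2) that(3) by (cases n) auto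
      then have "s > 0" by (simp add: s)
      have eq': "i * s + bucket s (2 ^ i) (b i) x = j * s + bucket s (2 ^ j) (b j) y"
        using eq w(2) that by simp
      have less: "bucket s (2 ^ i) (b i) x < s" "bucket s (2 ^ j) (b j) y < s"
        using bucket_less[OF \<open>s > 0\<close>] by auto
      \<comment> \<open>Dividing a position by \<open>s\<close> recovers its block number, as
        buckets are below \<open>s\<close>.\<close>
      have "i = j"
        using arg_cong[OF eq', of "\<lambda>u. u div s"] less \<open>s > 0\<close> by simp
      then show ?thesis using eq' by simp
    qed
    then have "{i \<in> {d..<2*d}. \<exists>j\<in>{d..<2*d}. \<exists>y\<in>A. position (word_code w) i x = position (word_code w) j y}
        \<subseteq> {i \<in> {d..<2*d}. \<exists>y\<in>A. bucket s (2 ^ i) (b i) x = bucket s (2 ^ i) (b i) y}"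
      by blast
    then have "card {i \<in> {d..<2*d}. \<exists>j\<in>{d..<2*d}. \<exists>y\<in>A. position (word_code w) i x = position (word_code w) j y}
        \<le> card {i \<in> {d..<2*d}. \<exists>y\<in>A. bucket s (2 ^ i) (b i) x = bucket s (2 ^ i) (b i) y}"
      by (intro card_mono) auto
    then show ?thesis using b(2) x by (meson le_less_trans mult_le_mono2)
  qed
  ultimately show ?thesis using w(1) by blast
qed

text \<open>The extra cell serves \<open>n = 0\<close>: then \<open>s = 0\<close> and every probe goes to position 0.\<close>

definition hash_scheme :: "(nat set \<Rightarrow> bool list) \<Rightarrow> nat \<Rightarrow> nat \<Rightarrow> bit_probe_scheme" where
  "hash_scheme C s t = \<lparr>
    cached = C,
    storage = (\<lambda>A. map (\<lambda>p. \<exists>j\<in>{2 ^ t..<2 * 2 ^ t}. \<exists>y\<in>A. p = position (word_code (C A)) j y)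
      [0..<2 * 2 ^ t * s + 1]),
    ncoins = t,
    probe = (\<lambda>x w r. position (word_code w) (word_code r) x),
    answer = (\<lambda>x w r b. b)\<rparr>"

lemma card_words: "card {r :: bool list. length r = t} = 2 ^ t"
  using card_lists_length_eq[of "UNIV :: bool set" t] by simp

lemma finite_words: "finite {r :: bool list. length r = t}"
  using finite_lists_length_eq[of "UNIV :: bool set" t] by simp

lemma prob_coins:
  "measure_pmf.prob (coins S) R = real (card ({r. length r = ncoins S} \<inter> R)) / 2 ^ ncoins S"
proof -
  have "{r :: bool list. length r = ncoins S} \<noteq> {}" using card_words[of "ncoins S"] by (metis card.empty power_not_zero zero_neq_numeral)
  then show ?thesis unfolding coins_def by (simp add: measure_pmf_of_set finite_words card_words)
qed

text \<open>A query says yes exactly when the probed cell is addressed by some element of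
  \<open>A\<close>. An element of \<open>A\<close> finds the cell it set itself; for other
  \<open>x\<close> the bad coin words inject into the fewer than \<open>d / k\<close> colliding
  blocks.\<close>

lemma one_sided_hash_scheme:
  fixes k :: nat
  assumes k: "k > 0" "1 / real k \<le> \<epsilon>" and d: "d = 2 ^ t"
    and bound: "\<And>A i x. storable n m A \<Longrightarrow> i \<in> {d..<2*d} \<Longrightarrow> position (word_code (C A)) i x \<le> 2 * d * s"
    and few: "\<And>A x. storable n m A \<Longrightarrow> x \<in> {1..m} - A \<Longrightarrow>
      k * card {i \<in> {d..<2*d}. \<exists>j\<in>{d..<2*d}. \<exists>y\<in>A. position (word_code (C A)) i x = position (word_code (C A)) j y} < d"
  shows "one_sided_scheme \<epsilon> n m (hash_scheme C s t)"
  unfolding one_sided_scheme_def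
proof (intro allI impI ballI conjI)
  fix A x assume A: "storable n m A" and x: "x \<in> {1..m}"
  let ?S = "hash_scheme C s t"
  let ?pos = "position (word_code (C A))"
  have coin: "word_code r \<in> {d..<2*d}" if "length r = t" for r
    using word_code_ge[of r] word_code_less[of r] that by (simp add: d)
  have len: "length (storage ?S A) = 2 * d * s + 1" by (simp add: hash_scheme_def d)
  have query: "query ?S A x r \<longleftrightarrow> (\<exists>j\<in>{d..<2*d}. \<exists>y\<in>A. ?pos (word_code r) x = ?pos j y)"
    if "length r = t" for r
  proof -
    have "?pos (word_code r) x < 2 * d * s + 1" using bound[OF A coin[OF that], of x] by simp
    then show ?thesis by (simp add: query_def hash_scheme_def d del: upt_Suc)
  qed
  {
    fix r :: "bool list" assume "length r = ncoins ?S"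
    then have "length r = t" by (simp add: hash_scheme_def)
    then show "probe ?S x (cached ?S A) r < length (storage ?S A)"
      using bound[OF A coin, of r x] unfolding len by (simp add: hash_scheme_def)
  }
  {
    assume "x \<in> A"
    then have "{r. length r = t} \<inter> {r. query ?S A x r} = {r. length r = t}"
      using query coin by blast
    then show "measure_pmf.prob (coins ?S) {r. query ?S A x r} = 1"
      unfolding prob_coins by (simp add: card_words hash_scheme_def)
  }
  {
    assume "x \<notin> A"
    define J where "J = {i \<in> {d..<2*d}. \<exists>j\<in>{d..<2*d}. \<exists>y\<in>A. ?pos i x = ?pos j y}"
    have "card ({r. length r = t} \<inter> {r. query ?S A x r}) \<le> card J"
    proof (rule card_inj_on_le)
      show "inj_on word_code ({r. length r = t} \<inter> {r. query ?S A x r})"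
        by (rule inj_onI) (auto intro: word_code_inject_length)
      show "word_code ` ({r. length r = t} \<inter> {r. query ?S A x r}) \<subseteq> J"
        using query coin by (auto simp: J_def)
    qed (simp add: J_def)
    then have "measure_pmf.prob (coins ?S) {r. query ?S A x r} \<le> real (card J) / real d"
      unfolding prob_coins by (simp add: hash_scheme_def d divide_right_mono)
    also have "\<dots> < 1 / real k"
    proof -
      have "k * card J < d" using few[OF A] x \<open>x \<notin> A\<close> by (simp add: J_def)
      then have "real k * real (card J) < real d" by (metis of_nat_less_iff of_nat_mult)
      then show ?thesis using k(1) d by (simp add: field_simps)
    qed
    finally show "measure_pmf.prob (coins ?S) {r. query ?S A x r} < \<epsilon>" using k(2) by simp
  }
qed

section \<open>Choice of parameters\<close>

text \<open>With \<open>l\<close> the bit length of \<open>m\<close>, the exponent \<open>e\<close>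
  bounds \<open>m * s\<close> by \<open>5 \<le> 2 ^ 3\<close>, \<open>4 ^ k = 2 ^ (2 * k)\<close>
  and \<open>n \<le> m < 2 ^ l\<close>. Rounding \<open>e\<close> up to a power of two, so that coin
  words enumerate the blocks, at most doubles it.\<close>

lemma block_count_exists:
  assumes "n \<le> m" "s = 5 * 4 ^ k * n"
  shows "\<exists>t d. d = 2 ^ t \<and> m * s \<le> 2 ^ d \<and> m < 2 ^ d \<and> s < 2 ^ d \<and>
    real d \<le> 10 + 4 * real k + 4 * log 2 (real m)"
proof -
  define l where "l = floorlog 2 m"
  define e where "e = 3 + 2 * k + 2 * l"
  define t where "t = floorlog 2 e"
  define d where "d = (2::nat) ^ t"
  have m: "m < 2 ^ l" unfolding l_def by (rule floorlog_leD) auto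
  have e: "2 ^ (t - 1) \<le> e" "e < d" "t > 0"
    using floorlog_bounds[of e 2] by (auto simp: t_def d_def e_def floorlog_def)
  have "d = 2 * 2 ^ (t - 1)" using e(3) by (simp add: d_def power_eq_if)
  with e(1) have "d \<le> 2 * e" by simp
  have l: "real l \<le> log 2 (real m) + 1"
  proof (cases "m = 0")
    case False
    then have "real l = of_int \<lfloor>log 2 (real m)\<rfloor> + 1" by (simp add: l_def floorlog_def)
    then show ?thesis by linarith
  qed (simp add: l_def floorlog_def log_def)
  have pow: "2 ^ e \<le> (2::nat) ^ d" using e(2) by simp
  have four: "(4::nat) ^ k = 2 ^ (2 * k)" by (simp add: power_mult)
  have "s \<le> 8 * 2 ^ (2 * k) * 2 ^ l"
    unfolding assms(2) four using assms(1) m by (intro mult_mono) auto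
  also have "\<dots> = 2 ^ (3 + 2 * k + l)" by (simp add: power_add)
  finally have s: "s \<le> 2 ^ (3 + 2 * k + l)" .
  have "m * s \<le> 2 ^ l * 2 ^ (3 + 2 * k + l)" using m s by (intro mult_mono) auto
  also have "\<dots> = 2 ^ e" by (simp add: e_def power_add[symmetric] algebra_simps mult_2)
  finally have "m * s \<le> 2 ^ d" using pow by linarith
  moreover have "m < 2 ^ d"
    by (rule less_le_trans[OF m]) (use e(2) in \<open>auto simp: e_def\<close>)
  moreover have "s < 2 ^ d"
    using s by (rule le_less_trans) (use e(2) in \<open>auto simp: e_def\<close>)
  moreover have "real d \<le> 10 + 4 * real k + 4 * log 2 (real m)"
  proof -
    have "real d \<le> real (2 * e)" using \<open>d \<le> 2 * e\<close> by (simp only: of_nat_le_iff)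
    then show ?thesis using l by (simp add: e_def)
  qed
  ultimately show ?thesis using d_def by blast
qed

text \<open>For \<open>m \<ge> 2\<close> the logarithm is at least 1, so a bound linear in it is
  also quadratic. The \<open>max 1\<close> absorbs \<open>n = 0\<close> and
  \<open>n = m = 1\<close>, where the product vanishes.\<close>

lemma storage_bound:
  assumes "n \<le> m" "real d \<le> c + 4 * log 2 (real m)" "c \<ge> 0" "b \<ge> 0"
  shows "2 * real d * (b * real n) + 1 \<le> (2 * (c + 4) * b + 1) * max 1 (real n * (log 2 (real m))\<^sup>2)"
proof -
  define L where "L = log 2 (real m)"
  consider "n = 0" | "n = 1" "m = 1" | "n \<ge> 1" "m \<ge> 2" using assms(1) by linarith
  then show ?thesis
  proof cases
    case 1
    have "1 * 1 \<le> (2 * (c + 4) * b + 1) * max 1 (real n * (log 2 (real m))\<^sup>2)"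
      using assms by (intro mult_mono) auto
    then show ?thesis using 1 by simp
  next
    case 2
    have "2 * real d * b \<le> 2 * (c + 4) * b"
      using assms 2 by (intro mult_right_mono) auto
    then show ?thesis using 2 by simp
  next
    case 3
    have L: "L \<ge> 1" using 3 by (simp add: L_def le_log_iff)
    have "real d \<le> c * 1 + 4 * L" using assms(2) by (simp add: L_def)
    also have "\<dots> \<le> c * L\<^sup>2 + 4 * L\<^sup>2"
      using L assms(3) self_le_power[of L 2] by (intro add_mono mult_left_mono) auto
    finally have "real d \<le> (c + 4) * L\<^sup>2" by (simp add: algebra_simps)
    then have "2 * real d * (b * real n) \<le> 2 * ((c + 4) * L\<^sup>2) * (b * real n)"
      using assms(4) by (intro mult_right_mono) auto
    moreover have "1 * 1 \<le> real n * L\<^sup>2" using 3 L by (intro mult_mono) auto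
    ultimately have "2 * real d * (b * real n) + 1 \<le> (2 * (c + 4) * b + 1) * (real n * L\<^sup>2)"
      by (simp add: algebra_simps)
    also have "\<dots> \<le> (2 * (c + 4) * b + 1) * max 1 (real n * L\<^sup>2)"
      using assms by (intro mult_left_mono) auto
    finally show ?thesis by (simp add: L_def)
  qed
qed

theorem theorem5:
  fixes \<epsilon> :: real
  assumes "\<epsilon> > 0"
  shows "\<exists>(P :: com) (K :: real) (p :: real poly) (q :: real poly).
    \<forall>(n :: nat) (m :: nat). n \<le> m \<longrightarrow>
      (\<exists>S :: bit_probe_scheme. one_sided_scheme \<epsilon> n m S \<and>
        (\<forall>A. storable n m A \<longrightarrow>
           real (length (storage S A)) \<le> K * max 1 (real n * (log 2 (real m))\<^sup>2) \<and>
           real (length (cached S A)) \<le> poly p (log 2 (real m)) \<and>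
           (\<forall>x\<in>{1..m}. \<forall>r. length r = ncoins S \<longrightarrow>
              computes_within P x (cached S A) r (probe S x (cached S A) r)
                (poly q (log 2 (real m))))))"
proof -
  obtain k :: nat where k: "k > 0" "1 / real k \<le> \<epsilon>"
    using ex_inverse_of_nat_less[OF assms] by (auto simp: inverse_eq_divide intro: less_imp_le)
  define K where "K = 2 * (10 + 4 * real k + 4) * (5 * 4 ^ k) + 1"
  \<comment> \<open>\<open>\<delta>\<close> bounds \<open>d\<close> as a polynomial in
    \<open>log 2 m\<close>; \<open>p\<close> follows the cache length \<open>d * (2 * d + 1)\<close>
    and \<open>q\<close> the running time \<open>2000 * d ^ 3\<close>.\<close>
  define \<delta> where "\<delta> = [:10 + 4 * real k, 4:]"
  define p where "p = \<delta> * (2 * \<delta> + 1)"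
  define q where "q = smult 2000 (\<delta> ^ 3)"
  show ?thesis
  \<comment> \<open>One program serves all \<open>n\<close> and \<open>m\<close>: the parameters
    reach it only through the cached word and the block number given by the coins.\<close>
  proof (rule exI[of _ probe_program], rule exI[of _ K], rule exI[of _ p], rule exI[of _ q], intro allI impI)
    fix n m :: nat assume nm: "n \<le> m"
    define s where "s = 5 * 4 ^ k * n"
    obtain t d where d: "d = 2 ^ t" "m * s \<le> 2 ^ d" "m < 2 ^ d" "s < 2 ^ d"
      and dL: "real d \<le> 10 + 4 * real k + 4 * log 2 (real m)"
      using block_count_exists[OF nm s_def] by blast
    have \<delta>: "real d \<le> poly \<delta> (log 2 (real m))" using dL by (simp add: \<delta>_def)
    have "d > 0" using d(1) by simp
    have "\<exists>C. \<forall>A. storable n m A \<longrightarrow> length (C A) = triangle (2 * d) \<and>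
      (\<forall>i\<in>{d..<2*d}. \<forall>x. position (word_code (C A)) i x \<le> 2 * d * s) \<and>
      (\<forall>x\<in>{1..m} - A. k * card {i \<in> {d..<2*d}. \<exists>j\<in>{d..<2*d}. \<exists>y\<in>A.
          position (word_code (C A)) i x = position (word_code (C A)) j y} < d)"
      by (intro choice allI)
        (use cached_word_exists[OF _ _ s_def d(2-4) \<open>d > 0\<close>] in \<open>auto simp: storable_def\<close>)
    then obtain C where C: "\<And>A. storable n m A \<Longrightarrow> length (C A) = triangle (2 * d)"
      "\<And>A i x. storable n m A \<Longrightarrow> i \<in> {d..<2*d} \<Longrightarrow> position (word_code (C A)) i x \<le> 2 * d * s"
      "\<And>A x. storable n m A \<Longrightarrow> x \<in> {1..m} - A \<Longrightarrow>
        k * card {i \<in> {d..<2*d}. \<exists>j\<in>{d..<2*d}. \<exists>y\<in>A.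
          position (word_code (C A)) i x = position (word_code (C A)) j y} < d"
      by blast
    let ?S = "hash_scheme C s t"
    show "\<exists>S. one_sided_scheme \<epsilon> n m S \<and>
        (\<forall>A. storable n m A \<longrightarrow>
           real (length (storage S A)) \<le> K * max 1 (real n * (log 2 (real m))\<^sup>2) \<and>
           real (length (cached S A)) \<le> poly p (log 2 (real m)) \<and>
           (\<forall>x\<in>{1..m}. \<forall>r. length r = ncoins S \<longrightarrow>
              computes_within probe_program x (cached S A) r (probe S x (cached S A) r)
                (poly q (log 2 (real m)))))"
    proof (rule exI[of _ ?S], intro conjI allI impI ballI)
      show "one_sided_scheme \<epsilon> n m ?S"
        by (rule one_sided_hash_scheme[OF k d(1) C(2,3)])
    next
      fix A assume A: "storable n m A"
      have "real (length (storage ?S A)) = 2 * real d * ((5 * 4 ^ k) * real n) + 1"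
        by (simp add: hash_scheme_def d(1) s_def)
      also have "\<dots> \<le> K * max 1 (real n * (log 2 (real m))\<^sup>2)"
        unfolding K_def using dL by (intro storage_bound nm) auto
      finally show "real (length (storage ?S A)) \<le> K * max 1 (real n * (log 2 (real m))\<^sup>2)" .
      have "real (length (cached ?S A)) = real d * (2 * real d + 1)"
        using C(1)[OF A] unfolding triangle_double by (simp add: hash_scheme_def algebra_simps)
      also have "\<dots> \<le> poly p (log 2 (real m))"
        unfolding p_def poly_mult using \<delta> by (intro mult_mono) auto
      finally show "real (length (cached ?S A)) \<le> poly p (log 2 (real m))" .
    next
      fix A x and r :: "bool list" assume A: "storable n m A" and x: "x \<in> {1..m}" and r: "length r = ncoins ?S"
      have rt: "length r = t" using r by (simp add: hash_scheme_def)
      have "triangle (2 * d) + 1 = 2 * d\<^sup>2 + d + 1"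
        unfolding triangle_double by (simp add: power2_eq_square algebra_simps)
      then have "word_code (C A) < 2 ^ (2 * d\<^sup>2 + d + 1)"
        using word_code_less[of "C A"] C(1)[OF A] by (metis Suc_eq_plus1)
      moreover have "x < 2 ^ d" using x d(3) by simp
      moreover have "0 < word_code r" "word_code r < 2 * d"
        using word_code_ge[of r] word_code_less[of r] rt d(1) by (auto intro: less_le_trans[of 0 "2 ^ t"])
      ultimately have "computes_within probe_program x (C A) r
          (position (word_code (C A)) (word_code r) x) (2000 * real d ^ 3)"
        by (intro probe_program_correct) auto
      moreover have "2000 * real d ^ 3 \<le> poly q (log 2 (real m))"
        unfolding q_def using \<delta> by (simp add: power_mono)
      ultimately show "computes_within probe_program x (cached ?S A) r (probe ?S x (cached ?S A) r)
          (poly q (log 2 (real m)))"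
        unfolding computes_within_def by (auto simp: hash_scheme_def intro: order_trans)
    qed
  qed
qed

end
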